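(* Fix $\alpha\in[0,1)$ and let $s=d^{1-\alpha}$. Define $$\varepsilon_{\max}:=\sup\{\|\bm p-U([d])\|_1:\ \bm p\in\mathcal P([d]),\ \|\bm p-U([d])\|_0=s\}.$$ Then $$\lim_{d\to\infty}\frac{d\,\varepsilon_{\max}}{s}=2.$$
   Context: Here $\bm p$ denotes a vector (bold $p$). $[d]=\{1,\dots,d\}$; $\mathcal P([d])$ is the set of probability vectors $\bm p=(p_1,\dots,p_d)$ on $[d]$ (non-negative entries summing to $1$); $U([d])=(1/d,\dots,1/d)$ is the uniform distribution. $\|\cdot\|_0$ counts non-zero coordinates and $\|\cdot\|_1$ is the $L_1$ norm. The quantity $s=d^{1-\alpha}$ is treated as an integer. *)

theory Defs
  imports Complex_Main "HOL-Library.FuncSet"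
begin

text \<open>
  A vector indexed by \<open>[d] = {1..d}\<close> is a function \<open>nat \<Rightarrow> real\<close>; the dimension \<open>d\<close> is an
  explicit parameter because it tends to infinity. Only the entries with index in \<open>{1..d}\<close>
  enter the norms.
\<close>

definition prob_vectors :: "nat \<Rightarrow> (nat \<Rightarrow> real) set" where
  "prob_vectors d = {p \<in> {1..d} \<rightarrow>\<^sub>E {0..}. (\<Sum>i = 1..d. p i) = 1}"

definition uniform_vector :: "nat \<Rightarrow> nat \<Rightarrow> real" where
  "uniform_vector d = (\<lambda>i\<in>{1..d}. 1 / real d)"

definition l0_norm :: "nat \<Rightarrow> (nat \<Rightarrow> real) \<Rightarrow> nat" where
  "l0_norm d x = card {i \<in> {1..d}. x i \<noteq> 0}"

definition l1_norm :: "nat \<Rightarrow> (nat \<Rightarrow> real) \<Rightarrow> real" where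
  "l1_norm d x = (\<Sum>i = 1..d. \<bar>x i\<bar>)"

text \<open>
  For \<open>2 \<le> s \<le> d\<close> the set below is nonempty and bounded, so the supremum is the genuine one.
  For other \<open>s\<close> the set may be empty, and then its real-valued \<open>Sup\<close> carries no meaning.
\<close>

definition eps_max :: "nat \<Rightarrow> nat \<Rightarrow> real" where
  "eps_max d s =
     Sup {l1_norm d (\<lambda>i. p i - uniform_vector d i) | p.
            p \<in> prob_vectors d \<and> l0_norm d (\<lambda>i. p i - uniform_vector d i) = s}"

text \<open>
  The sparsity \<open>s = d\<^sup>1\<^sup>-\<^sup>\<alpha>\<close>, treated as an integer: \<open>s d\<close> is an integer at distance less than \<open>1\<close>
  from the real power. This forces equality whenever the power is an integer, and otherwise
  leaves exactly the choice between rounding down and rounding up.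
\<close>

definition integer_power :: "real \<Rightarrow> (nat \<Rightarrow> nat) \<Rightarrow> bool" where
  "integer_power \<alpha> s \<longleftrightarrow> (\<forall>d. \<bar>real (s d) - real d powr (1 - \<alpha>)\<bar> < 1)"

end

theory Submission
  imports Defs "HOL-Real_Asymp.Real_Asymp"
begin

text \<open>
  The deviations of a probability vector from the uniform one are at least \<open>-1/d\<close> in every
  coordinate, and they sum to zero. So the positive and the negative deviations have the same total, and
  the \<open>L\<^sub>1\<close> distance is twice the negative total. Among \<open>s\<close> nonzero deviations at least
  one is positive, which leaves at most \<open>s - 1\<close> negative ones of size at most \<open>1/d\<close> each
  (\<open>sum_abs_le_of_bounded_below\<close>). Emptying \<open>s - 1\<close> coordinates into a single one meets this
  bound, hence the supremum is exactly \<open>2 (s - 1) / d\<close> for \<open>2 \<le> s \<le> d\<close>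
  (\<open>eps_max_eq\<close>).

  The quotient of interest is therefore \<open>2 - 2 / s\<close> as soon as \<open>2 \<le> s \<le> d\<close>, and it tends
  to \<open>2\<close> because \<open>s\<close> stays within distance \<open>1\<close> of \<open>d powr (1 - \<alpha>)\<close>, which tends to
  infinity.
\<close>

text \<open>
  Since \<open>\<bar>t\<bar> = t + 2 max 0 (-t)\<close> and the entries sum to zero, only negative entries
  contribute, each at most \<open>2 c\<close>. They form a proper subset of the support: if every nonzero
  entry were negative, so would be the sum.
\<close>

lemma sum_abs_le_of_bounded_below:
  fixes x :: "'a \<Rightarrow> real"
  assumes fin: "finite A" and zero: "sum x A = 0"
    and low: "\<And>i. i \<in> A \<Longrightarrow> - c \<le> x i" and "0 \<le> c"
    and supp: "card {i \<in> A. x i \<noteq> 0} = s" "0 < s"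
  shows "(\<Sum>i\<in>A. \<bar>x i\<bar>) \<le> 2 * c * (real s - 1)"
proof -
  define N where "N = {i \<in> A. x i < 0}"
  define S where "S = {i \<in> A. x i \<noteq> 0}"
  have "N \<noteq> S"
  proof
    assume "N = S"
    have "S \<noteq> {}" "finite S"
      using supp fin by (auto simp: S_def card_gt_0_iff)
    then have "sum x S < sum (\<lambda>_. 0) S"
      using \<open>N = S\<close> by (intro sum_strict_mono) (auto simp: N_def)
    moreover have "sum x A = sum x S"
      using fin by (intro sum.mono_neutral_right) (auto simp: S_def)
    ultimately show False using zero by simp
  qed
  then have "N \<subset> S" by (auto simp: N_def S_def)
  then have "card N < s"
    using psubset_card_mono[of S N] fin supp by (simp add: S_def)
  then have card_N: "real (card N) \<le> real s - 1" by linarith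
  have "(\<Sum>i\<in>A. \<bar>x i\<bar>) \<le> (\<Sum>i\<in>A. x i + (if i \<in> N then 2 * c else 0))"
  proof (rule sum_mono)
    fix i assume "i \<in> A"
    then show "\<bar>x i\<bar> \<le> x i + (if i \<in> N then 2 * c else 0)"
      using low[of i] by (auto simp: N_def)
  qed
  also have "\<dots> = (\<Sum>i\<in>A. if i \<in> N then 2 * c else 0)"
    by (simp add: sum.distrib zero)
  also have "\<dots> = 2 * c * real (card N)"
  proof -
    have "A \<inter> N = N" by (auto simp: N_def)
    then show ?thesis using fin by (simp add: sum.If_cases)
  qed
  also have "\<dots> \<le> 2 * c * (real s - 1)"
    using card_N \<open>0 \<le> c\<close> by (intro mult_left_mono) auto
  finally show ?thesis .
qed

lemma l1_dist_uniform_le: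
  assumes p: "p \<in> prob_vectors d" and "1 \<le> d" "1 \<le> s"
    and "l0_norm d (\<lambda>i. p i - uniform_vector d i) = s"
  shows "l1_norm d (\<lambda>i. p i - uniform_vector d i) \<le> 2 * (real s - 1) / real d"
proof -
  have "(\<Sum>i\<in>{1..d}. \<bar>p i - uniform_vector d i\<bar>) \<le> 2 * (1 / real d) * (real s - 1)"
  proof (rule sum_abs_le_of_bounded_below)
    show "(\<Sum>i = 1..d. p i - uniform_vector d i) = 0"
      using p \<open>1 \<le> d\<close> by (simp add: prob_vectors_def sum_subtractf uniform_vector_def)
    show "- (1 / real d) \<le> p i - uniform_vector d i" if "i \<in> {1..d}" for i
      using p that by (auto simp: prob_vectors_def uniform_vector_def PiE_def Pi_def)
  qed (use assms in \<open>auto simp: l0_norm_def\<close>)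
  then show ?thesis by (simp add: l1_norm_def)
qed

text \<open>
  The witness moves the mass of the coordinates \<open>2, \<dots>, s\<close> to the first one. For \<open>s \<ge> 2\<close>
  the first deviation \<open>(s - 1) / d\<close> is nonzero, so the support has exactly \<open>s\<close> elements.
\<close>

lemma l1_dist_uniform_attained:
  assumes "2 \<le> s" "s \<le> d"
  obtains p where "p \<in> prob_vectors d"
    "l0_norm d (\<lambda>i. p i - uniform_vector d i) = s"
    "l1_norm d (\<lambda>i. p i - uniform_vector d i) = 2 * (real s - 1) / real d"
proof -
  define p :: "nat \<Rightarrow> real" where
    "p = (\<lambda>i\<in>{1..d}. if i = 1 then real s / real d else if i \<le> s then 0 else 1 / real d)"
  define x where "x = (\<lambda>i. p i - uniform_vector d i)"
  have d: "0 < real d" using assms by simp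
  have x1: "x 1 = (real s - 1) / real d"
    using assms by (simp add: x_def p_def uniform_vector_def diff_divide_distrib)
  have x_mid: "x i = - 1 / real d" if "i \<in> {2..s}" for i
    using that assms by (auto simp: x_def p_def uniform_vector_def)
  have x_high: "x i = 0" if "i \<in> {Suc s..d}" for i
    using that assms by (auto simp: x_def p_def uniform_vector_def)
  \<comment> \<open>Used for the identity, which gives total mass one, and for the absolute value.\<close>
  have split: "(\<Sum>i = 1..d. f (x i)) = f ((real s - 1) / real d) + (real s - 1) * f (- 1 / real d)"
    if "f 0 = 0" for f :: "real \<Rightarrow> real"
  proof -
    have "(\<Sum>i = 1..d. f (x i)) = (\<Sum>i = 1..s. f (x i))"
      using assms that x_high by (intro sum.mono_neutral_right) (auto simp: not_le)
    also have "{1..s} = insert 1 {2..s}" using assms by auto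
    also have "(\<Sum>i\<in>insert 1 {2..s}. f (x i)) = f (x 1) + (\<Sum>i\<in>{2..s}. f (x i))"
      by simp
    also have "(\<Sum>i\<in>{2..s}. f (x i)) = (\<Sum>i\<in>{2..s}. f (- 1 / real d))"
      using x_mid by (intro sum.cong) auto
    finally show ?thesis using assms x1 by (simp add: of_nat_diff)
  qed
  have "(\<Sum>i = 1..d. x i) = 0" using split[of "\<lambda>t. t"] by simp
  then have "(\<Sum>i = 1..d. p i) = 1"
    using d by (simp add: x_def sum_subtractf uniform_vector_def)
  then have "p \<in> prob_vectors d"
    by (auto simp: prob_vectors_def p_def)
  moreover have "{i \<in> {1..d}. x i \<noteq> 0} = {1..s}"
  proof -
    have "x i \<noteq> 0 \<longleftrightarrow> i \<le> s" if "i \<in> {1..d}" for i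
    proof -
      have "i = 1 \<or> i \<in> {2..s} \<or> i \<in> {Suc s..d}"
        using that by auto
      then show ?thesis
        using x1 x_mid x_high assms d by auto
    qed
    then have "{i \<in> {1..d}. x i \<noteq> 0} = {i \<in> {1..d}. i \<le> s}"
      by (intro Collect_cong conj_cong refl)
    also have "\<dots> = {1..s}" using assms by auto
    finally show ?thesis .
  qed
  then have "l0_norm d x = s" by (simp add: l0_norm_def)
  moreover have "l1_norm d x = 2 * (real s - 1) / real d"
    using split[of abs] assms d by (simp add: l1_norm_def)
  ultimately show thesis using that by (simp add: x_def)
qed

lemma eps_max_eq:
  assumes "2 \<le> s" "s \<le> d"
  shows "eps_max d s = 2 * (real s - 1) / real d"
  unfolding eps_max_def
proof (rule cSup_eq_maximum)
  show "2 * (real s - 1) / real d \<in> {l1_norm d (\<lambda>i. p i - uniform_vector d i) | p.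
      p \<in> prob_vectors d \<and> l0_norm d (\<lambda>i. p i - uniform_vector d i) = s}"
  proof -
    obtain p where "p \<in> prob_vectors d"
      "l0_norm d (\<lambda>i. p i - uniform_vector d i) = s"
      "l1_norm d (\<lambda>i. p i - uniform_vector d i) = 2 * (real s - 1) / real d"
      using l1_dist_uniform_attained[OF assms] .
    then show ?thesis by (auto intro!: exI[of _ p])
  qed
qed (use assms l1_dist_uniform_le in auto)

lemma integer_power_le:
  assumes "integer_power \<alpha> s" "0 \<le> \<alpha>" "1 \<le> d"
  shows "s d \<le> d"
proof -
  have "real d powr (1 - \<alpha>) \<le> real d powr 1"
    using assms by (intro powr_mono) auto
  moreover have "\<bar>real (s d) - real d powr (1 - \<alpha>)\<bar> < 1"
    using assms by (simp add: integer_power_def)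
  ultimately have "real (s d) < real d + 1" using assms by simp
  then show ?thesis by linarith
qed

lemma integer_power_at_top:
  assumes "integer_power \<alpha> s" "\<alpha> < 1"
  shows "filterlim (\<lambda>d. real (s d)) at_top sequentially"
proof (rule filterlim_at_top_mono)
  have "filterlim (\<lambda>d. real d powr (1 - \<alpha>)) at_top sequentially"
    using assms by real_asymp
  then show "filterlim (\<lambda>d. - 1 + real d powr (1 - \<alpha>)) at_top sequentially"
    by (rule filterlim_tendsto_add_at_top[OF tendsto_const])
  show "eventually (\<lambda>d. - 1 + real d powr (1 - \<alpha>) \<le> real (s d)) sequentially"
  proof (intro always_eventually allI)
    fix d
    have "\<bar>real (s d) - real d powr (1 - \<alpha>)\<bar> < 1"
      using assms by (simp add: integer_power_def)
    then show "- 1 + real d powr (1 - \<alpha>) \<le> real (s d)" by linarith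
  qed
qed

theorem proposition1p1:
  fixes \<alpha> :: real and s :: "nat \<Rightarrow> nat"
  assumes "0 \<le> \<alpha>" and "\<alpha> < 1"
    and "integer_power \<alpha> s"
  shows "(\<lambda>d. real d * eps_max d (s d) / real (s d)) \<longlonglongrightarrow> 2"
proof -
  have s_top: "filterlim (\<lambda>d. real (s d)) at_top sequentially"
    using assms by (intro integer_power_at_top)
  have "(\<lambda>d. 2 - 2 / real (s d)) \<longlonglongrightarrow> 2 - 0"
    by (intro tendsto_diff tendsto_const real_tendsto_divide_at_top[OF tendsto_const s_top])
  then have lim: "(\<lambda>d. 2 - 2 / real (s d)) \<longlonglongrightarrow> 2" by simp
  have "eventually (\<lambda>d. 2 \<le> real (s d)) sequentially"
    using s_top unfolding filterlim_at_top by blast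
  then have "eventually (\<lambda>d. 2 - 2 / real (s d) = real d * eps_max d (s d) / real (s d)) sequentially"
    using eventually_ge_at_top[of 1]
  proof eventually_elim
    case (elim d)
    then have "2 \<le> s d" "s d \<le> d"
      using integer_power_le[of \<alpha> s d] assms by auto
    then show ?case
      by (simp add: eps_max_eq field_simps)
  qed
  with lim show ?thesis by (rule Lim_transform_eventually)
qed

end
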